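(* Let $n\ge 1$. Any implementation, in an asynchronous shared memory system of $n$ processes communicating only through atomic multi-reader multi-writer read/write registers, of a long-lived unbounded timestamp object that satisfies non-deterministic solo-termination uses at least $n/6-1$ registers.
   Context: Model. There is a set $\{p_1,\dots,p_n\}$ of $n$ processes with distinct identifiers (different processes may run different programs) and a set $\{r_1,\dots,r_m\}$ of $m$ shared registers that support atomic read and write operations by every process; a register may hold arbitrary values. Processes communicate only via these operations and are scheduled asynchronously: an execution is a sequence of steps, arbitrarily interleaved among processes, starting from the initial configuration. A configuration consists of the state of every process and the value of every register. Processes may make arbitrary non-deterministic decisions, but every execution must be correct, i.e. responses must match the specification below. Timestamp object. An unbounded timestamp object supports two methods, $\mathrm{getTS}()$ and $\mathrm{compare}(t_1,t_2)$. $\mathrm{getTS}()$ takes no input and outputs a timestamp from an arbitrary (possibly infinite) universe $\mathcal{T}$; $\mathrm{compare}$ takes two timestamps and returns true or false. A method call $g_1$ happens before $g_2$, written $g_1\to g_2$, if the response of $g_1$ occurs before the invocation of $g_2$. The only requirement is: if two $\mathrm{getTS}$ calls $g_1,g_2$ return $t_1,t_2$ respectively and $g_1\to g_2$, then any later call $\mathrm{compare}(t_1,t_2)$ returns true and any later call $\mathrm{compare}(t_2,t_1)$ returns false. The object is long-lived if each process may invoke $\mathrm{getTS}$ arbitrarily many times. (The number of $\mathrm{compare}$ calls is not restricted.) Progress. An implementation satisfies non-deterministic solo-termination if for any configuration $C$ and any process $p_i$ there is an execution from $C$ in which no process other than $p_i$ takes steps and $p_i$ finishes its method call within a finite number of steps.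 *)

theory Defs
  imports Complex_Main
begin

datatype 't call = GetTS | Compare 't 't

datatype 't result = Timestamp 't | Truth bool

text \<open>
  One atomic step a process may choose to take inside a pending call.  Each action carries the
  local state the process moves to; for a read it depends on the value read, so a process
  cannot refuse a value.
\<close>

datatype ('s, 'v, 't) action =
    Read nat "'v \<Rightarrow> 's"
  | Write nat 'v 's
  | Local 's
  | Return "'t result" 's

text \<open>
  An implementation gives every process its own program.  Non-determinism is expressed by
  \<open>actions\<close>, the set of steps available to a process in a given local state.  The local state
  is kept between successive calls of the same process, and \<open>start\<close> is total because an idle
  process has to accept every call.
\<close>

record ('s, 'v, 't) impl =
  init_state :: "nat \<Rightarrow> 's"
  init_reg :: "nat \<Rightarrow> 'v"
  start :: "nat \<Rightarrow> 's \<Rightarrow> 't call \<Rightarrow> 's"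
  actions :: "nat \<Rightarrow> 's \<Rightarrow> ('s, 'v, 't) action set"

text \<open>A process is \<open>Idle\<close> between calls and \<open>Active\<close> while it has a pending call.\<close>

datatype 's proc = Idle 's | Active 's

record ('s, 'v) config =
  procs :: "nat \<Rightarrow> 's proc"
  regs :: "nat \<Rightarrow> 'v"

definition init_config :: "('s, 'v, 't) impl \<Rightarrow> ('s, 'v) config" where
  "init_config I = \<lparr>procs = (\<lambda>p. Idle (init_state I p)), regs = init_reg I\<rparr>"

datatype 't event = Invoke "'t call" | Respond "'t result" | Internal

text \<open>
  The processes are the numbers below \<open>n\<close> and the registers the numbers below \<open>m\<close>; an action on
  any other register is never enabled.  An idle process can always invoke another call, so the
  object is long-lived.
\<close>

inductive step ::
  "nat \<Rightarrow> nat \<Rightarrow> ('s, 'v, 't) impl \<Rightarrow> ('s, 'v) config \<Rightarrow> nat \<times> 't event \<Rightarrow> ('s, 'v) config \<Rightarrow> bool"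
  for n m :: nat and I :: "('s, 'v, 't) impl" where
  step_invoke: "\<lbrakk>p < n; procs C p = Idle s\<rbrakk>
    \<Longrightarrow> step n m I C (p, Invoke c) (C\<lparr>procs := (procs C)(p := Active (start I p s c))\<rparr>)"
| step_read: "\<lbrakk>p < n; procs C p = Active s; Read r k \<in> actions I p s; r < m\<rbrakk>
    \<Longrightarrow> step n m I C (p, Internal) (C\<lparr>procs := (procs C)(p := Active (k (regs C r)))\<rparr>)"
| step_write: "\<lbrakk>p < n; procs C p = Active s; Write r v s' \<in> actions I p s; r < m\<rbrakk>
    \<Longrightarrow> step n m I C (p, Internal)
          (C\<lparr>procs := (procs C)(p := Active s'), regs := (regs C)(r := v)\<rparr>)"
| step_local: "\<lbrakk>p < n; procs C p = Active s; Local s' \<in> actions I p s\<rbrakk>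
    \<Longrightarrow> step n m I C (p, Internal) (C\<lparr>procs := (procs C)(p := Active s')\<rparr>)"
| step_return: "\<lbrakk>p < n; procs C p = Active s; Return x s' \<in> actions I p s\<rbrakk>
    \<Longrightarrow> step n m I C (p, Respond x) (C\<lparr>procs := (procs C)(p := Idle s')\<rparr>)"

inductive execution ::
  "nat \<Rightarrow> nat \<Rightarrow> ('s, 'v, 't) impl \<Rightarrow> ('s, 'v) config \<Rightarrow> (nat \<times> 't event) list
     \<Rightarrow> ('s, 'v) config \<Rightarrow> bool"
  for n m :: nat and I :: "('s, 'v, 't) impl" where
  execution_Nil: "execution n m I C [] C"
| execution_Cons: "\<lbrakk>step n m I C e C'; execution n m I C' es C''\<rbrakk> \<Longrightarrow> execution n m I C (e # es) C''"

definition reachable :: "nat \<Rightarrow> nat \<Rightarrow> ('s, 'v, 't) impl \<Rightarrow> ('s, 'v) config \<Rightarrow> bool" where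
  "reachable n m I C \<longleftrightarrow> (\<exists>es. execution n m I (init_config I) es C)"

text \<open>
  Process \<open>p\<close> invokes \<open>c\<close> at position \<open>i\<close> of the event sequence \<open>h\<close> and gets the matching response
  \<open>x\<close> at position \<open>j\<close>.
\<close>

definition call_in ::
  "(nat \<times> 't event) list \<Rightarrow> nat \<Rightarrow> nat \<Rightarrow> nat \<Rightarrow> 't call \<Rightarrow> 't result \<Rightarrow> bool" where
  "call_in h p i j c x \<longleftrightarrow>
     i < j \<and> j < length h \<and> h ! i = (p, Invoke c) \<and> h ! j = (p, Respond x) \<and>
     (\<forall>k. i < k \<and> k < j \<and> fst (h ! k) = p \<longrightarrow> snd (h ! k) = Internal)"

fun result_fits :: "'t call \<Rightarrow> 't result \<Rightarrow> bool" where
  "result_fits GetTS x \<longleftrightarrow> (\<exists>t. x = Timestamp t)"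
| "result_fits (Compare t1 t2) x \<longleftrightarrow> (\<exists>b. x = Truth b)"

definition timestamp_spec :: "(nat \<times> 't event) list \<Rightarrow> bool" where
  "timestamp_spec h \<longleftrightarrow>
     (\<forall>p i j c x. call_in h p i j c x \<longrightarrow> result_fits c x) \<and>
     (\<forall>p1 i1 j1 t1 p2 i2 j2 t2 p3 i3 j3 x.
        call_in h p1 i1 j1 GetTS (Timestamp t1) \<and>
        call_in h p2 i2 j2 GetTS (Timestamp t2) \<and> j1 < i2 \<and> j2 < i3 \<longrightarrow>
          (call_in h p3 i3 j3 (Compare t1 t2) x \<longrightarrow> x = Truth True) \<and>
          (call_in h p3 i3 j3 (Compare t2 t1) x \<longrightarrow> x = Truth False))"

definition long_lived_timestamp_impl :: "nat \<Rightarrow> nat \<Rightarrow> ('s, 'v, 't) impl \<Rightarrow> bool" where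
  "long_lived_timestamp_impl n m I \<longleftrightarrow>
     (\<forall>es C. execution n m I (init_config I) es C \<longrightarrow> timestamp_spec es)"

text \<open>
  Only reachable configurations are considered.  Only processes with a pending call are
  mentioned, since an idle process acquires one by its next step, an invocation.
\<close>

definition nondet_solo_termination :: "nat \<Rightarrow> nat \<Rightarrow> ('s, 'v, 't) impl \<Rightarrow> bool" where
  "nondet_solo_termination n m I \<longleftrightarrow>
     (\<forall>C p s. reachable n m I C \<and> p < n \<and> procs C p = Active s \<longrightarrow>
        (\<exists>es x C'. execution n m I C (es @ [(p, Respond x)]) C' \<and> (\<forall>e \<in> set es. fst e = p)))"

end

theory Submission
  imports Defs
begin

text \<open>
  By induction on \<open>k\<close>, any \<open>2 * k\<close> idle processes can reach a configuration in which \<open>k\<close> of them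
  are poised to write and no register is covered more than three times; hence \<open>k \<le> 3 * m\<close>.

  For the induction step set two processes \<open>q0\<close>, \<open>q1\<close> aside and let the others visit such
  configurations for \<open>k\<close> again and again; by the pigeonhole principle the set \<open>X\<close> of the registers
  covered three times is the same at two visits.  Split the processes covering \<open>X\<close> into three
  blocks, each covering \<open>X\<close>.  If \<open>q0\<close>, run alone after the first block write, and \<open>q1\<close>, run alone
  after the second, could both finish a getTS call writing inside \<open>X\<close> only, then the two orders
  of these runs followed by the third block write would lead to the same configuration, in which
  no correct answer to a comparison of the two timestamps exists.  So one of them, started at the
  earlier visit, gets poised to write outside \<open>X\<close>, and the block write of another block hides all
  it did; it is the additional covering process at the later visit.
\<close>

section \<open>Executions\<close>

lemma execution_append:
  assumes "execution n m I C es C'" and "execution n m I C' fs C''"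
  shows "execution n m I C (es @ fs) C''"
  using assms by (induction rule: execution.induct) (auto intro: execution.intros)

lemma execution_single: "step n m I C e C' \<Longrightarrow> execution n m I C [e] C'"
  by (auto intro: execution.intros)

lemma reachable_execution:
  assumes "reachable n m I C" and "execution n m I C es C'"
  shows "reachable n m I C'"
  using assms execution_append unfolding reachable_def by blast

lemma step_procs_other:
  assumes "step n m I C e C'" and "p \<noteq> fst e"
  shows "procs C' p = procs C p"
  using assms by (auto elim!: step.cases)

lemma execution_procs_other:
  assumes "execution n m I C es C'" and "p \<notin> fst ` set es"
  shows "procs C' p = procs C p"
  using assms by (induction rule: execution.induct) (auto simp: step_procs_other)

text \<open>A step depends only on the registers and the state of the process taking it, so the
  states outside \<open>Q\<close> can be replaced by those of \<open>f\<close>. Both replay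
  principles below are instances: \<open>Q = {q}\<close> and \<open>Q = - {q}\<close>.\<close>

lemma step_override_procs:
  assumes "step n m I C e C'" and "fst e \<in> Q"
  shows "step n m I \<lparr>procs = override_on f (procs C) Q, regs = regs C\<rparr> e
    \<lparr>procs = override_on f (procs C') Q, regs = regs C'\<rparr>"
  using assms
proof (cases rule: step.cases)
  case (step_invoke p s c)
  let ?E = "\<lparr>procs = override_on f (procs C) Q, regs = regs C\<rparr>"
  have "\<lparr>procs = override_on f (procs C') Q, regs = regs C'\<rparr> =
      ?E\<lparr>procs := (procs ?E)(p := Active (start I p s c))\<rparr>"
    using step_invoke assms(2) by (auto simp: override_on_def fun_eq_iff)
  then show ?thesis
    using step_invoke assms(2) step.step_invoke[of p n ?E s m I c] by (simp add: override_on_def)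
next
  case (step_read p s r k)
  let ?E = "\<lparr>procs = override_on f (procs C) Q, regs = regs C\<rparr>"
  have "\<lparr>procs = override_on f (procs C') Q, regs = regs C'\<rparr> =
      ?E\<lparr>procs := (procs ?E)(p := Active (k (regs ?E r)))\<rparr>"
    using step_read assms(2) by (auto simp: override_on_def fun_eq_iff)
  then show ?thesis
    using step_read assms(2) step.step_read[of p n ?E s r k I m] by (simp add: override_on_def)
next
  case (step_write p s r v s')
  let ?E = "\<lparr>procs = override_on f (procs C) Q, regs = regs C\<rparr>"
  have "\<lparr>procs = override_on f (procs C') Q, regs = regs C'\<rparr> =
      ?E\<lparr>procs := (procs ?E)(p := Active s'), regs := (regs ?E)(r := v)\<rparr>"
    using step_write assms(2) by (auto simp: override_on_def fun_eq_iff)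
  then show ?thesis
    using step_write assms(2) step.step_write[of p n ?E s r v s' I m] by (simp add: override_on_def)
next
  case (step_local p s s')
  let ?E = "\<lparr>procs = override_on f (procs C) Q, regs = regs C\<rparr>"
  have "\<lparr>procs = override_on f (procs C') Q, regs = regs C'\<rparr> =
      ?E\<lparr>procs := (procs ?E)(p := Active s')\<rparr>"
    using step_local assms(2) by (auto simp: override_on_def fun_eq_iff)
  then show ?thesis
    using step_local assms(2) step.step_local[of p n ?E s s' I m] by (simp add: override_on_def)
next
  case (step_return p s x s')
  let ?E = "\<lparr>procs = override_on f (procs C) Q, regs = regs C\<rparr>"
  have "\<lparr>procs = override_on f (procs C') Q, regs = regs C'\<rparr> =
      ?E\<lparr>procs := (procs ?E)(p := Idle s')\<rparr>"
    using step_return assms(2) by (auto simp: override_on_def fun_eq_iff)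
  then show ?thesis
    using step_return assms(2) step.step_return[of p n ?E s x s' I m] by (simp add: override_on_def)
qed

lemma execution_override_procs:
  assumes "execution n m I C es C'" and "fst ` set es \<subseteq> Q"
  shows "execution n m I \<lparr>procs = override_on f (procs C) Q, regs = regs C\<rparr> es
    \<lparr>procs = override_on f (procs C') Q, regs = regs C'\<rparr>"
  using assms
  by (induction rule: execution.induct) (auto intro: execution.intros step_override_procs)

text \<open>A process running alone sees only its own state and the registers. This repeats a call
  in a configuration where other processes have moved meanwhile.\<close>

lemma execution_replay_solo:
  assumes "execution n m I C es C'" and "fst ` set es \<subseteq> {q}"
    and "procs E q = procs C q" and "regs E = regs C"
  shows "execution n m I E es \<lparr>procs = (procs E)(q := procs C' q), regs = regs C'\<rparr>"
proof -
  have "\<lparr>procs = override_on (procs E) (procs C) {q}, regs = regs C\<rparr> = E"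
    using assms(3,4) by (auto simp: override_on_def fun_eq_iff intro!: config.equality)
  moreover have "override_on (procs E) (procs C') {q} = (procs E)(q := procs C' q)"
    by (auto simp: override_on_def fun_eq_iff)
  ultimately show ?thesis
    using execution_override_procs[OF assms(1,2), of "procs E"] by simp
qed

text \<open>The others cannot see the state of \<open>q\<close>, so they may continue unchanged
  while \<open>q\<close> waits in front of a pending write.\<close>

lemma execution_ignore_proc:
  assumes "execution n m I C es C'" and "q \<notin> fst ` set es"
  shows "execution n m I (C\<lparr>procs := (procs C)(q := st)\<rparr>) es (C'\<lparr>procs := (procs C')(q := st)\<rparr>)"
proof -
  have "\<lparr>procs = override_on (\<lambda>_. st) (procs E) (- {q}), regs = regs E\<rparr>
      = E\<lparr>procs := (procs E)(q := st)\<rparr>" for E :: "('a, 'b) config"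
    by (auto simp: override_on_def fun_eq_iff intro!: config.equality)
  then show ?thesis
    using execution_override_procs[OF assms(1), of "- {q}" "\<lambda>_. st"] assms(2) by auto
qed

section \<open>Covering\<close>

text \<open>Stated for a process state instead of a configuration, so that it still applies when
  this state is inserted into another configuration.\<close>

definition poised where
  "poised m I p st x \<longleftrightarrow> (\<exists>s v s'. st = Active s \<and> Write x v s' \<in> actions I p s \<and> x < m)"

text \<open>Cut the run at the first configuration in which \<open>q\<close> may write outside
  \<open>X\<close>, even if the run takes another action there. Up to that point no register outside
  \<open>X\<close> has changed.\<close>

lemma solo_write_outside_cases:
  assumes "execution n m I C es C'" and "fst ` set es \<subseteq> {q}"
  shows "(\<forall>y. y \<notin> X \<longrightarrow> regs C' y = regs C y) \<or>
    (\<exists>fs F x. execution n m I C fs F \<and> fst ` set fs \<subseteq> {q} \<and>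
      (\<forall>y. y \<notin> X \<longrightarrow> regs F y = regs C y) \<and> x \<notin> X \<and> poised m I q (procs F q) x)"
  using assms
proof (induction rule: execution.induct)
  case (execution_Nil C)
  then show ?case by simp
next
  case (execution_Cons C e C' es C'')
  have q: "fst e = q" and es: "fst ` set es \<subseteq> {q}" using execution_Cons.prems by auto
  show ?case
  proof (cases "\<exists>x. x \<notin> X \<and> poised m I q (procs C q) x")
    case True
    then show ?thesis using execution.execution_Nil[of n m I C] by fastforce
  next
    case False
    have same: "regs C' y = regs C y" if "y \<notin> X" for y
      using execution_Cons.hyps(1) False q that unfolding poised_def
      by (cases rule: step.cases) (auto 4 4)
    from execution_Cons.IH[OF es] show ?thesis
    proof
      assume "\<forall>y. y \<notin> X \<longrightarrow> regs C'' y = regs C' y"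
      then show ?thesis using same by simp
    next
      assume "\<exists>fs F x. execution n m I C' fs F \<and> fst ` set fs \<subseteq> {q} \<and>
        (\<forall>y. y \<notin> X \<longrightarrow> regs F y = regs C' y) \<and> x \<notin> X \<and> poised m I q (procs F q) x"
      then obtain fs F x where "execution n m I C' fs F" "fst ` set fs \<subseteq> {q}"
        "\<forall>y. y \<notin> X \<longrightarrow> regs F y = regs C' y" "x \<notin> X" "poised m I q (procs F q) x"
        by blast
      then have "execution n m I C (e # fs) F \<and> fst ` set (e # fs) \<subseteq> {q} \<and>
        (\<forall>y. y \<notin> X \<longrightarrow> regs F y = regs C y) \<and> x \<notin> X \<and> poised m I q (procs F q) x"
        using same q execution_Cons.hyps(1) by (auto intro: execution.execution_Cons)
      then show ?thesis by blast
    qed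
  qed
qed

text \<open>Value \<open>w\<close> and next state \<open>l\<close> are indexed by the writing
  process, so disjoint blocks can share them. No order of the writes appears, because they concern
  distinct registers and distinct processes.\<close>

definition block_write ::
  "nat set \<Rightarrow> (nat \<Rightarrow> nat) \<Rightarrow> (nat \<Rightarrow> 'v) \<Rightarrow> (nat \<Rightarrow> 's) \<Rightarrow> ('s, 'v) config \<Rightarrow> ('s, 'v) config" where
  "block_write X b w l C =
    \<lparr>procs = \<lambda>p. if p \<in> b ` X then Active (l p) else procs C p,
     regs = \<lambda>y. if y \<in> X then w (b y) else regs C y\<rparr>"

text \<open>The writes are done one by one; injectivity of \<open>b\<close> ensures that each
  process is still in its original state when its turn comes.\<close>

lemma execution_block_write:
  assumes "finite X" and "inj_on b X"
    and "\<And>x. x \<in> X \<Longrightarrow> b x < n \<and> x < m \<and>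
      (\<exists>s. procs C (b x) = Active s \<and> Write x (w (b x)) (l (b x)) \<in> actions I (b x) s)"
  shows "\<exists>es. execution n m I C es (block_write X b w l C) \<and> fst ` set es \<subseteq> b ` X"
  using assms
proof (induction X)
  case empty
  have "block_write {} b w l C = C" by (simp add: block_write_def)
  then show ?case by (metis execution_Nil empty_subsetI image_empty list.set(1))
next
  case (insert x X)
  then obtain es where es: "execution n m I C es (block_write X b w l C)" "fst ` set es \<subseteq> b ` X"
    by (auto simp: inj_on_insert)
  let ?E = "block_write X b w l C"
  obtain s where s: "procs C (b x) = Active s" "Write x (w (b x)) (l (b x)) \<in> actions I (b x) s"
    and "b x < n" "x < m" using insert.prems(2) by blast
  have new: "b x \<notin> b ` X" using insert.prems(1) insert.hyps by auto
  have "block_write (insert x X) b w l C =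
      ?E\<lparr>procs := (procs ?E)(b x := Active (l (b x))), regs := (regs ?E)(x := w (b x))\<rparr>"
    by (auto simp: block_write_def fun_eq_iff)
  moreover have "step n m I ?E (b x, Internal)
      (?E\<lparr>procs := (procs ?E)(b x := Active (l (b x))), regs := (regs ?E)(x := w (b x))\<rparr>)"
    using s \<open>b x < n\<close> \<open>x < m\<close> new by (intro step_write) (auto simp: block_write_def)
  ultimately have "execution n m I C (es @ [(b x, Internal)]) (block_write (insert x X) b w l C)"
    using es(1) by (metis execution_append execution_single)
  then show ?case using es(2) by (intro exI[of _ "es @ [(b x, Internal)]"]) auto
qed

section \<open>Complete calls\<close>

text \<open>The run provided by solo termination may contain several calls of \<open>p\<close>.
  Cutting it at the first response leaves only internal events in between, as \<open>call_in\<close>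
  demands.\<close>

lemma first_response:
  assumes "execution n m I C es C'" and "procs C p = Active s"
    and "fst ` set es \<subseteq> {p}" and "(p, Respond x) \<in> set es"
  shows "\<exists>fs y F. execution n m I C (fs @ [(p, Respond y)]) F \<and> set fs \<subseteq> {(p, Internal)}"
  using assms
proof (induction arbitrary: s rule: execution.induct)
  case (execution_Nil C)
  then show ?case by simp
next
  case (execution_Cons C e C' es C'')
  show ?case
  proof (cases "\<exists>y. e = (p, Respond y)")
    case True
    then have "execution n m I C ([] @ [e]) C'" using execution_Cons.hyps(1)
      by (simp add: execution_single)
    then show ?thesis using True by (metis empty_set empty_subsetI)
  next
    case False
    have "fst e = p" using execution_Cons.prems by auto
    then have e: "e = (p, Internal)" and act: "\<exists>s'. procs C' p = Active s'"
      using execution_Cons.hyps(1) execution_Cons.prems(1) False by (auto elim!: step.cases)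
    then obtain fs y F where
      "execution n m I C' (fs @ [(p, Respond y)]) F" "set fs \<subseteq> {(p, Internal)}"
      using execution_Cons.IH execution_Cons.prems(2,3) by auto
    then show ?thesis using execution_Cons.hyps(1) e
      by (intro exI[of _ "e # fs"] exI[of _ y] exI[of _ F]) (auto intro: execution.execution_Cons)
  qed
qed

lemma execution_last_response:
  assumes "execution n m I C (es @ [(p, Respond x)]) C'"
  shows "\<exists>s. procs C' p = Idle s"
  using assms
  by (induction es arbitrary: C) (auto elim!: execution.cases[of _ _ _ _ "_ # _"]
      execution.cases[of _ _ _ _ "[]"] step.cases[of _ _ _ _ "(p, Respond x)"])

lemma call_in_middle:
  assumes "set es \<subseteq> {(p, Internal)}"
  shows "call_in (h @ (p, Invoke c) # es @ (p, Respond x) # h') p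
    (length h) (Suc (length h + length es)) c x"
proof -
  have "snd ((h @ (p, Invoke c) # es @ (p, Respond x) # h') ! k) = Internal"
    if "length h < k" "k < Suc (length h + length es)" for k
  proof -
    have "(h @ (p, Invoke c) # es @ (p, Respond x) # h') ! k = es ! (k - Suc (length h))"
      using that by (auto simp: nth_append nth_Cons')
    moreover have "es ! (k - Suc (length h)) \<in> set es"
      using that by (intro nth_mem) auto
    ultimately show ?thesis using assms by auto
  qed
  then show ?thesis unfolding call_in_def by (auto simp: nth_append)
qed

section \<open>Solo calls of a correct, terminating implementation\<close>

locale timestamp_impl =
  fixes n m :: nat and I :: "('s, 'v, 't) impl"
  assumes correct: "long_lived_timestamp_impl n m I"
    and terminating: "nondet_solo_termination n m I"
begin

lemma solo_response:
  assumes "reachable n m I C" and "p < n" and "procs C p = Active s"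
  shows "\<exists>es x C'. execution n m I C (es @ [(p, Respond x)]) C' \<and> set es \<subseteq> {(p, Internal)}"
proof -
  obtain es x C' where es: "execution n m I C (es @ [(p, Respond x)]) C'" "\<forall>e \<in> set es. fst e = p"
    using terminating assms unfolding nondet_solo_termination_def by meson
  then show ?thesis using first_response[OF es(1) assms(3)] by auto
qed

text \<open>Termination yields some response after the invocation; that it has the right kind
  follows from the specification, applied to a full history through \<open>C\<close> ending with
  this call.\<close>

lemma solo_call:
  assumes "reachable n m I C" and "p < n" and "procs C p = Idle s"
  shows "\<exists>es x C'. execution n m I C ((p, Invoke c) # es @ [(p, Respond x)]) C' \<and>
    set es \<subseteq> {(p, Internal)} \<and> result_fits c x"
proof -
  let ?C = "C\<lparr>procs := (procs C)(p := Active (start I p s c))\<rparr>"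
  have st: "step n m I C (p, Invoke c) ?C" using assms by (intro step_invoke)
  then have "reachable n m I ?C" using assms(1) reachable_execution execution_single by metis
  then obtain es x C' where es: "execution n m I ?C (es @ [(p, Respond x)]) C'"
    and int: "set es \<subseteq> {(p, Internal)}"
    using solo_response[of ?C p] assms(2) by auto
  have ex: "execution n m I C ((p, Invoke c) # es @ [(p, Respond x)]) C'"
    using st es by (rule execution_Cons)
  obtain h where "execution n m I (init_config I) h C" using assms(1) unfolding reachable_def ..
  then have "timestamp_spec (h @ (p, Invoke c) # es @ [(p, Respond x)])"
    using ex correct execution_append unfolding long_lived_timestamp_impl_def by blast
  then have "result_fits c x"
    using call_in_middle[OF int, of h c x "[]"] unfolding timestamp_spec_def by blast
  then show ?thesis using ex int by blast
qed

text \<open>The pending calls are finished one process at a time; each solo run leaves the processes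
  that are already idle untouched.\<close>

lemma all_idle:
  assumes "finite W" and "W \<subseteq> {..<n}" and "reachable n m I C"
  shows "\<exists>es C'. execution n m I C es C' \<and> fst ` set es \<subseteq> W \<and> (\<forall>p\<in>W. \<exists>s. procs C' p = Idle s)"
  using assms
proof (induction W)
  case empty
  have "execution n m I C [] C" by (rule execution_Nil)
  then show ?case by fastforce
next
  case (insert p W)
  then obtain es C' where es: "execution n m I C es C'" "fst ` set es \<subseteq> W"
    and idle: "\<forall>p\<in>W. \<exists>s. procs C' p = Idle s" by auto
  show ?case
  proof (cases "procs C' p")
    case (Idle s)
    then show ?thesis using es idle by blast
  next
    case (Active s)
    obtain fs x C'' where fs: "execution n m I C' (fs @ [(p, Respond x)]) C''"
      "set fs \<subseteq> {(p, Internal)}"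
      using solo_response[OF reachable_execution[OF insert.prems(2) es(1)] _ Active] insert.prems(1)
      by auto
    have "fst ` set (fs @ [(p, Respond x)]) \<subseteq> {p}" using fs(2) by auto
    then have "procs C'' q = procs C' q" if "q \<noteq> p" for q
      using execution_procs_other[OF fs(1)] that by blast
    then have "\<forall>q\<in>insert p W. \<exists>s. procs C'' q = Idle s"
      using idle insert.hyps(2) execution_last_response[OF fs(1)] by (metis insert_iff)
    moreover have "fst ` set (es @ fs @ [(p, Respond x)]) \<subseteq> insert p W" using es(2) fs(2) by auto
    ultimately show ?thesis using execution_append[OF es(1) fs(1)] by blast
  qed
qed

text \<open>Only the final configuration \<open>D\<close> links the comparison to the earlier steps.
  Hence the same comparison can follow two executions that run the getTS calls in opposite orders
  but both end in \<open>D\<close>.\<close>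

lemma compare_after_sequential:
  assumes "execution n m I (init_config I) h C"
    and "execution n m I C (u0 @ ((p, Invoke GetTS) # es @ [(p, Respond (Timestamp t))]) @
      u1 @ ((q, Invoke GetTS) # fs @ [(q, Respond (Timestamp t'))]) @ u2) D"
    and "set es \<subseteq> {(p, Internal)}" and "set fs \<subseteq> {(q, Internal)}"
    and "execution n m I D ((c, Invoke (Compare a b)) # gs @ [(c, Respond x)]) D'"
    and "set gs \<subseteq> {(c, Internal)}"
  shows "(a, b) = (t, t') \<Longrightarrow> x = Truth True" and "(a, b) = (t', t) \<Longrightarrow> x = Truth False"
proof -
  let ?l = "(c, Invoke (Compare a b)) # gs @ [(c, Respond x)]"
  let ?h1 = "h @ u0"
  let ?h2 = "?h1 @ ((p, Invoke GetTS) # es @ [(p, Respond (Timestamp t))]) @ u1"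
  let ?h3 = "?h2 @ ((q, Invoke GetTS) # fs @ [(q, Respond (Timestamp t'))]) @ u2"
  have "execution n m I (init_config I) (?h3 @ ?l) D'"
    using execution_append[OF assms(1) execution_append[OF assms(2,5)]] by simp
  then have spec: "timestamp_spec (?h3 @ ?l)"
    using correct unfolding long_lived_timestamp_impl_def by blast
  have "call_in (?h3 @ ?l) p (length ?h1) (Suc (length ?h1 + length es)) GetTS (Timestamp t)"
    using call_in_middle[OF assms(3), of ?h1] by simp
  moreover have "call_in (?h3 @ ?l) q (length ?h2) (Suc (length ?h2 + length fs))
      GetTS (Timestamp t')"
    using call_in_middle[OF assms(4), of ?h2] by simp
  moreover have "call_in (?h3 @ ?l) c (length ?h3) (Suc (length ?h3 + length gs)) (Compare a b) x"
    using call_in_middle[OF assms(6), of ?h3] by simp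
  moreover have "Suc (length ?h1 + length es) < length ?h2"
    "Suc (length ?h2 + length fs) < length ?h3" by auto
  ultimately show "(a, b) = (t, t') \<Longrightarrow> x = Truth True" "(a, b) = (t', t) \<Longrightarrow> x = Truth False"
    using spec unfolding timestamp_spec_def by blast+
qed

section \<open>A hidden process poised outside the triply covered registers\<close>

text \<open>The runs \<open>es\<close> without \<open>q\<close> and \<open>fs\<close> with
  \<open>q\<close> end in configurations differing only in the state of \<open>q\<close>, so the
  others can continue from both alike. If no such pair existed, both getTS calls would write inside
  \<open>X\<close> only, and their order could be concealed.\<close>

lemma hidden_covering:
  assumes D: "reachable n m I D"
    and P: "P \<subseteq> {..<n}" "\<forall>p \<in> P. poised m I p (procs D p) (r p)"
    and q: "q0 \<noteq> q1" "{q0, q1} \<inter> P = {}" "{q0, q1} \<subseteq> {..<n}"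
    and idle: "\<forall>q \<in> {q0, q1}. \<exists>s. procs D q = Idle s"
  defines "X \<equiv> {x. card {p \<in> P. r p = x} = 3}"
  shows "\<exists>q \<in> {q0, q1}. \<exists>es D' fs st x. execution n m I D es D' \<and> fst ` set es \<subseteq> P \<and>
    execution n m I D fs (D'\<lparr>procs := (procs D')(q := st)\<rparr>) \<and> fst ` set fs \<subseteq> insert q P \<and>
    x \<notin> X \<and> poised m I q st x" (is ?hidden)
proof (rule ccontr)
  assume none: "\<not> ?hidden"
  have finP: "finite P" using P(1) finite_subset by blast
  have XP: "X \<subseteq> r ` P"
  proof
    fix x assume "x \<in> X"
    then have "{p \<in> P. r p = x} \<noteq> {}" unfolding X_def by (auto simp del: Collect_empty_eq)
    then show "x \<in> r ` P" by blast
  qed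
  then have finX: "finite X" using finP finite_surj by blast
  \<comment> \<open>Enumerate the three processes covering \<open>x\<close>: the \<open>i\<close>-th
    block consists of the processes \<open>b x i\<close> for \<open>x\<close> in
    \<open>X\<close>.\<close>
  have "\<exists>g. bij_betw g {0..<3::nat} {p \<in> P. r p = x}" if "x \<in> X" for x
    using ex_bij_betw_nat_finite[of "{p \<in> P. r p = x}"] finP that unfolding X_def by simp
  then obtain b where b: "\<And>x. x \<in> X \<Longrightarrow> bij_betw (b x) {0..<3::nat} {p \<in> P. r p = x}"
    by metis
  have bP: "b x i \<in> P" "r (b x i) = x" if "x \<in> X" "i < 3" for x i
    using bij_betwE[OF b[OF that(1)]] that(2) by auto
  have b_inj: "x = y \<and> i = j" if "b x i = b y j" "x \<in> X" "y \<in> X" "i < 3" "j < 3" for x y i j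
  proof -
    have xy: "x = y" using bP(2) that by metis
    then show ?thesis
      using bij_betw_imp_inj_on[OF b[OF \<open>x \<in> X\<close>]] that by (auto simp: inj_on_def)
  qed
  \<comment> \<open>A poised process may have several writes available. One value and next state per
    process are fixed, so that block writes have the same effect in different executions.\<close>
  have "\<forall>p\<in>P. \<exists>vl. \<exists>s. procs D p = Active s \<and> Write (r p) (fst vl) (snd vl) \<in> actions I p s"
    using P(2) unfolding poised_def by (metis fst_conv snd_conv)
  then obtain vl where vl: "\<And>p. p \<in> P \<Longrightarrow>
      \<exists>s. procs D p = Active s \<and> Write (r p) (fst (vl p)) (snd (vl p)) \<in> actions I p s"
    by metis
  define w l where "w = (\<lambda>p. fst (vl p))" and "l = (\<lambda>p. snd (vl p))"
  define B where "B i = (\<lambda>x. b x i) ` X" for i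
  define W where "W i = block_write X (\<lambda>x. b x i) w l" for i
  have BP: "B i \<subseteq> P" if "i < 3" for i using bP that unfolding B_def by auto
  have disj: "B i \<inter> B j = {}" if "i < 3" "j < 3" "i \<noteq> j" for i j
    using b_inj that unfolding B_def by blast
  have procs_W: "procs (W i E) p = (if p \<in> B i then Active (l p) else procs E p)"
    and regs_W: "regs (W i E) y = (if y \<in> X then w (b y i) else regs E y)" for i E p y
    unfolding W_def B_def block_write_def by auto
  \<comment> \<open>Block \<open>i\<close> can write from any configuration \<open>E\<close> in
    which its processes are still as in \<open>D\<close>.\<close>
  have W: "\<exists>es. execution n m I E es (W i E) \<and> fst ` set es \<subseteq> P"
    if "i < 3" and same: "\<And>p. p \<in> B i \<Longrightarrow> procs E p = procs D p" for i E
  proof -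
    have "inj_on (\<lambda>x. b x i) X" using b_inj[of _ i _ i] that(1) by (intro inj_onI) blast
    moreover have "b x i < n \<and> x < m \<and>
      (\<exists>s. procs E (b x i) = Active s \<and> Write x (w (b x i)) (l (b x i)) \<in> actions I (b x i) s)"
      if "x \<in> X" for x
    proof -
      note bx = bP[OF that(1) \<open>i < 3\<close>]
      have "b x i < n" using bx P(1) by auto
      moreover have "x < m" using bspec[OF P(2) bx(1)] bx(2) unfolding poised_def by auto
      moreover have "procs E (b x i) = procs D (b x i)"
        using same[of "b x i"] that unfolding B_def by blast
      ultimately show ?thesis using vl[OF bx(1)] bx(2) unfolding w_def l_def by auto
    qed
    ultimately obtain es where "execution n m I E es (W i E)" "fst ` set es \<subseteq> B i"
      using execution_block_write[OF finX, of "\<lambda>x. b x i" n m E w l I] unfolding W_def B_def by auto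
    then show ?thesis using BP[OF that(1)] by blast
  qed
  have qB: "q \<notin> B i" if "q \<in> {q0, q1}" "i < 3" for q i using q(2) BP that by auto
  \<comment> \<open>One choice of call must serve both orders. It is therefore stated for every
    \<open>E\<close> that looks to \<open>q\<close> like \<open>D\<close> after block write
    \<open>i\<close>. Block \<open>j\<close> serves to refute a change outside
    \<open>X\<close>.\<close>
  have call: "\<exists>es t f g. set es \<subseteq> {(q, Internal)} \<and> (\<forall>y. y \<notin> X \<longrightarrow> g y = regs D y) \<and>
      (\<forall>E. procs E q = procs D q \<longrightarrow> regs E = regs (W i D) \<longrightarrow>
        execution n m I E ((q, Invoke GetTS) # es @ [(q, Respond (Timestamp t))])
          \<lparr>procs = (procs E)(q := Idle f), regs = g\<rparr>)"
    if "q \<in> {q0, q1}" "i < 3" "j < 3" "i \<noteq> j" for q i j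
  proof -
    obtain us where us: "execution n m I D us (W i D)" "fst ` set us \<subseteq> P"
      using W[OF \<open>i < 3\<close>, of D] by blast
    have "procs (W i D) q = procs D q" using procs_W qB that by simp
    then obtain s where s: "procs (W i D) q = Idle s" using bspec[OF idle \<open>q \<in> {q0, q1}\<close>] by auto
    have "q < n" using q(3) that(1) by auto
    obtain es x C' where es: "execution n m I (W i D) ((q, Invoke GetTS) # es @ [(q, Respond x)]) C'"
        "set es \<subseteq> {(q, Internal)}" and "result_fits GetTS x"
      using solo_call[OF reachable_execution[OF D us(1)] \<open>q < n\<close> s, of GetTS] by blast
    then obtain t where t: "x = Timestamp t" by auto
    obtain f where f: "procs C' q = Idle f"
      using execution_last_response[of n m I "W i D" "(q, Invoke GetTS) # es" q x C'] es(1) by auto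
    have solo: "fst ` set ((q, Invoke GetTS) # es @ [(q, Respond x)]) \<subseteq> {q}" using es(2) by auto
    have "regs C' y = regs (W i D) y" if "y \<notin> X" for y
    proof (rule ccontr)
      assume "regs C' y \<noteq> regs (W i D) y"
      then obtain fs F z where fs: "execution n m I (W i D) fs F" "fst ` set fs \<subseteq> {q}"
          and F: "\<forall>y. y \<notin> X \<longrightarrow> regs F y = regs (W i D) y" and z: "z \<notin> X" "poised m I q (procs F q) z"
        using solo_write_outside_cases[OF es(1) solo, of X] \<open>y \<notin> X\<close> by blast
      have procs_F: "procs F p = procs (W i D) p" if "p \<noteq> q" for p
        using execution_procs_other[OF fs(1)] fs(2) that by blast
      obtain vs where vs: "execution n m I (W i D) vs (W j (W i D))" "fst ` set vs \<subseteq> P"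
        using W[OF \<open>j < 3\<close>, of "W i D"] procs_W[of i D]
          disj[OF \<open>i < 3\<close> \<open>j < 3\<close> \<open>i \<noteq> j\<close>]
        by (meson disjoint_iff)
      have "procs F p = procs D p" if "p \<in> B j" for p
        using that procs_F[of p] qB[OF \<open>q \<in> {q0, q1}\<close> \<open>j < 3\<close>] procs_W
          disj[OF \<open>i < 3\<close> \<open>j < 3\<close> \<open>i \<noteq> j\<close>] by (metis disjoint_iff)
      then obtain ws where ws: "execution n m I F ws (W j F)" "fst ` set ws \<subseteq> P"
        using W[OF \<open>j < 3\<close>, of F] by blast
      let ?D' = "W j (W i D)"
      \<comment> \<open>\<open>F\<close> and \<open>W i D\<close> differ only in registers of
        \<open>X\<close>, which block \<open>j\<close> overwrites, and in the state of
        \<open>q\<close>. This is the hidden covering excluded by \<open>none\<close>.\<close>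
      have "W j F = ?D'\<lparr>procs := (procs ?D')(q := procs F q)\<rparr>"
        using F procs_F qB[OF \<open>q \<in> {q0, q1}\<close> \<open>j < 3\<close>]
        by (intro config.equality) (auto simp: procs_W regs_W fun_eq_iff)
      then have "execution n m I D (us @ fs @ ws) (?D'\<lparr>procs := (procs ?D')(q := procs F q)\<rparr>)"
        using us(1) fs(1) ws(1) execution_append by metis
      moreover have "execution n m I D (us @ vs) ?D'" using us(1) vs(1) by (rule execution_append)
      moreover have "fst ` set (us @ vs) \<subseteq> P" "fst ` set (us @ fs @ ws) \<subseteq> insert q P"
        using us(2) vs(2) fs(2) ws(2) by auto
      ultimately have ?hidden using z
        by (intro bexI[OF _ \<open>q \<in> {q0, q1}\<close>] exI[of _ "us @ vs"] exI[of _ ?D']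
            exI[of _ "us @ fs @ ws"] exI[of _ "procs F q"] exI[of _ z] conjI)
      with none show False ..
    qed
    then have "\<forall>y. y \<notin> X \<longrightarrow> regs C' y = regs D y" using regs_W by simp
    moreover have "execution n m I E ((q, Invoke GetTS) # es @ [(q, Respond (Timestamp t))])
        \<lparr>procs = (procs E)(q := Idle f), regs = regs C'\<rparr>"
      if "procs E q = procs D q" "regs E = regs (W i D)" for E
      using execution_replay_solo[OF es(1) solo, of E] that t f
        \<open>procs (W i D) q = procs D q\<close> by simp
    ultimately show ?thesis using es(2) by blast
  qed
  \<comment> \<open>Block \<open>i\<close>, call of \<open>p\<close>, block \<open>j\<close>, call
    of \<open>p'\<close>, block 2. The final configuration is written out explicitly, to show that
    it stays the same when the two block-call pairs are swapped.\<close>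
  have order: "\<exists>u0 u1 u2. execution n m I D
      (u0 @ ((p, Invoke GetTS) # es @ [(p, Respond (Timestamp t))]) @
       u1 @ ((p', Invoke GetTS) # es' @ [(p', Respond (Timestamp t'))]) @ u2)
      \<lparr>procs = \<lambda>c. if c \<in> B 0 \<union> B 1 \<union> B 2 then Active (l c)
          else ((procs D)(p := Idle f, p' := Idle f')) c,
       regs = \<lambda>y. if y \<in> X then w (b y 2) else regs D y\<rparr>"
    if pp: "p \<in> {q0, q1}" "p' \<in> {q0, q1}" "p \<noteq> p'"
      and ij: "(i, j) \<in> {(0, 1), (1, 0)}"
      and g: "\<forall>y. y \<notin> X \<longrightarrow> g y = regs D y" "\<forall>y. y \<notin> X \<longrightarrow> g' y = regs D y"
      and run: "\<forall>E. procs E p = procs D p \<longrightarrow> regs E = regs (W i D) \<longrightarrow>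
        execution n m I E ((p, Invoke GetTS) # es @ [(p, Respond (Timestamp t))])
          \<lparr>procs = (procs E)(p := Idle f), regs = g\<rparr>"
        "\<forall>E. procs E p' = procs D p' \<longrightarrow> regs E = regs (W j D) \<longrightarrow>
        execution n m I E ((p', Invoke GetTS) # es' @ [(p', Respond (Timestamp t'))])
          \<lparr>procs = (procs E)(p' := Idle f'), regs = g'\<rparr>"
    for p p' i j es es' t t' f f' g g'
  proof -
    have lt: "i < 3" "j < 3" "i \<noteq> 2" "j \<noteq> 2" "i \<noteq> j" using ij by auto
    note out = qB[OF pp(1)] qB[OF pp(2)]
    define E1 where "E1 = W i D"
    define E2 where "E2 = \<lparr>procs = (procs E1)(p := Idle f), regs = g\<rparr>"
    define E3 where "E3 = W j E2"
    define E4 where "E4 = \<lparr>procs = (procs E3)(p' := Idle f'), regs = g'\<rparr>"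
    define E5 where "E5 = W 2 E4"
    obtain u0 where u0: "execution n m I D u0 E1" using W[OF lt(1), of D] E1_def by auto
    have e2: "execution n m I E1 ((p, Invoke GetTS) # es @ [(p, Respond (Timestamp t))]) E2"
      using run(1) out lt procs_W unfolding E2_def E1_def by auto
    have "procs E2 c = procs D c" if "c \<in> B j" for c
      using that disj[of i j] lt out(1)[OF lt(2)] by (auto simp: E2_def E1_def procs_W)
    then obtain u1 where u1: "execution n m I E2 u1 E3" using W[OF lt(2), of E2] E3_def by auto
    \<comment> \<open>The call of \<open>p\<close> changed registers of \<open>X\<close> only, and
      block \<open>j\<close> overwrites these: \<open>p'\<close> cannot tell that \<open>p\<close>
      has run.\<close>
    have "regs E3 = regs (W j D)" using g(1) by (auto simp: E3_def E2_def regs_W fun_eq_iff)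
    moreover have "procs E3 p' = procs D p'"
      using out lt pp(3) by (auto simp: E3_def E2_def E1_def procs_W)
    ultimately have e4:
      "execution n m I E3 ((p', Invoke GetTS) # es' @ [(p', Respond (Timestamp t'))]) E4"
      using run(2) unfolding E4_def by auto
    have "procs E4 c = procs D c" if "c \<in> B 2" for c
      using that disj[of i 2] disj[of j 2] lt out(1)[of 2] out(2)[of 2]
      by (auto simp: E4_def E3_def E2_def E1_def procs_W)
    then obtain u2 where u2: "execution n m I E4 u2 E5" using W[of 2 E4] E5_def by auto
    have "B 0 \<union> B 1 = B i \<union> B j" using ij by auto
    then have "E5 = \<lparr>procs = \<lambda>c. if c \<in> B 0 \<union> B 1 \<union> B 2 then Active (l c)
          else ((procs D)(p := Idle f, p' := Idle f')) c,
       regs = \<lambda>y. if y \<in> X then w (b y 2) else regs D y\<rparr>"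
      using out lt g(2) pp(3)
      by (intro config.equality)
        (auto simp: E5_def E4_def E3_def E2_def E1_def procs_W regs_W fun_eq_iff)
    moreover have "execution n m I D (u0 @ ((p, Invoke GetTS) # es @ [(p, Respond (Timestamp t))]) @
       u1 @ ((p', Invoke GetTS) # es' @ [(p', Respond (Timestamp t'))]) @ u2) E5"
      using execution_append[OF u0 execution_append[OF e2 execution_append[OF u1
            execution_append[OF e4 u2]]]] .
    ultimately show ?thesis by metis
  qed
  obtain es0 t0 f0 g0 where 0: "set es0 \<subseteq> {(q0, Internal)}" "\<forall>y. y \<notin> X \<longrightarrow> g0 y = regs D y"
    "\<forall>E. procs E q0 = procs D q0 \<longrightarrow> regs E = regs (W 0 D) \<longrightarrow>
        execution n m I E ((q0, Invoke GetTS) # es0 @ [(q0, Respond (Timestamp t0))])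
          \<lparr>procs = (procs E)(q0 := Idle f0), regs = g0\<rparr>"
    using call[of q0 0 1] by auto
  obtain es1 t1 f1 g1 where 1: "set es1 \<subseteq> {(q1, Internal)}" "\<forall>y. y \<notin> X \<longrightarrow> g1 y = regs D y"
    "\<forall>E. procs E q1 = procs D q1 \<longrightarrow> regs E = regs (W 1 D) \<longrightarrow>
        execution n m I E ((q1, Invoke GetTS) # es1 @ [(q1, Respond (Timestamp t1))])
          \<lparr>procs = (procs E)(q1 := Idle f1), regs = g1\<rparr>"
    using call[of q1 1 0] by auto
  define G where "G = \<lparr>procs = \<lambda>c. if c \<in> B 0 \<union> B 1 \<union> B 2 then Active (l c)
          else ((procs D)(q0 := Idle f0, q1 := Idle f1)) c,
       regs = \<lambda>y. if y \<in> X then w (b y 2) else regs D y\<rparr>"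
  obtain u0 u1 u2 where u: "execution n m I D
      (u0 @ ((q0, Invoke GetTS) # es0 @ [(q0, Respond (Timestamp t0))]) @
       u1 @ ((q1, Invoke GetTS) # es1 @ [(q1, Respond (Timestamp t1))]) @ u2) G"
    using order[OF _ _ q(1) _ 0(2) 1(2) 0(3) 1(3)] unfolding G_def by auto
  have swap: "(procs D)(q1 := Idle f1, q0 := Idle f0) = (procs D)(q0 := Idle f0, q1 := Idle f1)"
    using q(1) by (rule fun_upd_twist[OF not_sym])
  obtain v0 v1 v2 where v: "execution n m I D
      (v0 @ ((q1, Invoke GetTS) # es1 @ [(q1, Respond (Timestamp t1))]) @
       v1 @ ((q0, Invoke GetTS) # es0 @ [(q0, Respond (Timestamp t0))]) @ v2) G"
    using order[OF _ _ q(1)[symmetric] _ 1(2) 0(2) 1(3) 0(3)] unfolding swap G_def by auto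
  \<comment> \<open>\<open>q0\<close> is idle in \<open>G\<close>, since it belongs to no block. One
    solo comparison from \<open>G\<close> extends both executions; the first order forces the answer
    true, the second false.\<close>
  have "procs G q0 = Idle f0" using qB[of q0] q(1) unfolding G_def by simp
  then obtain gs x G' where gs: "set gs \<subseteq> {(q0, Internal)}"
      "execution n m I G ((q0, Invoke (Compare t0 t1)) # gs @ [(q0, Respond x)]) G'"
    using solo_call[OF reachable_execution[OF D u], of q0 f0 "Compare t0 t1"] q(3) by auto
  obtain h where h: "execution n m I (init_config I) h D" using D unfolding reachable_def ..
  have "x = Truth True" using compare_after_sequential(1)[OF h u 0(1) 1(1) gs(2,1)] by simp
  moreover have "x = Truth False"
    using compare_after_sequential(2)[OF h v 1(1) 0(1) gs(2,1)] by simp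
  ultimately show False by simp
qed

section \<open>Repeated visits and the induction on the number of covering processes\<close>

text \<open>After a hidden covering the processes of \<open>W\<close> finish their calls, which
  makes them ready for the induction hypothesis. They do not notice \<open>q\<close>, which keeps
  its pending write.\<close>

lemma next_visit:
  assumes D: "reachable n m I D"
    and W: "W \<subseteq> {..<n}" "P \<subseteq> W" "\<forall>p \<in> P. poised m I p (procs D p) (r p)"
    and q: "q0 \<noteq> q1" "{q0, q1} \<inter> W = {}" "{q0, q1} \<subseteq> {..<n}"
    and idle: "\<forall>q \<in> {q0, q1}. \<exists>s. procs D q = Idle s"
  shows "\<exists>q \<in> {q0, q1}. \<exists>es D' fs st x. execution n m I D es D' \<and> fst ` set es \<subseteq> W \<and>
    (\<forall>p \<in> W. \<exists>s. procs D' p = Idle s) \<and>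
    execution n m I D fs (D'\<lparr>procs := (procs D')(q := st)\<rparr>) \<and> fst ` set fs \<subseteq> insert q W \<and>
    card {p \<in> P. r p = x} \<noteq> 3 \<and> poised m I q st x"
proof -
  have Pn: "P \<subseteq> {..<n}" and qP: "{q0, q1} \<inter> P = {}" using W(1,2) q(2) by blast+
  obtain q es D' fs st x where q': "q \<in> {q0, q1}"
    and es: "execution n m I D es D'" "fst ` set es \<subseteq> P"
    and fs: "execution n m I D fs (D'\<lparr>procs := (procs D')(q := st)\<rparr>)" "fst ` set fs \<subseteq> insert q P"
    and x: "card {p \<in> P. r p = x} \<noteq> 3" "poised m I q st x"
    using hidden_covering[OF D Pn W(3) q(1) qP q(3) idle] by (elim bexE exE conjE) simp
  obtain us D'' where us: "execution n m I D' us D''" "fst ` set us \<subseteq> W"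
    "\<forall>p\<in>W. \<exists>s. procs D'' p = Idle s"
    using all_idle[OF finite_subset[OF W(1)] W(1) reachable_execution[OF D es(1)]] by auto
  have "q \<notin> fst ` set us" using us(2) q' q(2) by blast
  then have "execution n m I D (fs @ us) (D''\<lparr>procs := (procs D'')(q := st)\<rparr>)"
    using execution_append[OF fs(1)] execution_ignore_proc[OF us(1)] by blast
  moreover have "execution n m I D (es @ us) D''" using es(1) us(1) by (rule execution_append)
  moreover have "fst ` set (es @ us) \<subseteq> W" "fst ` set (fs @ us) \<subseteq> insert q W"
    using es(2) fs(2) us(2) W(2) by auto
  ultimately show ?thesis using us(3) x
    by (intro bexI[OF _ q'] exI[of _ "es @ us"] exI[of _ D''] exI[of _ "fs @ us"] exI[of _ st]
        exI[of _ x] conjI)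
qed

text \<open>Starting from an arbitrary reachable configuration with \<open>W\<close> idle lets the
  induction hypothesis be used repeatedly. Two processes are spent per covering process gained,
  because it is not known in advance which of the two can be hidden.\<close>

lemma covering_reachable:
  assumes "W \<subseteq> {..<n}" and "card W = 2 * k" and "reachable n m I C"
    and "\<forall>p \<in> W. \<exists>s. procs C p = Idle s"
  shows "\<exists>es D P r. execution n m I C es D \<and> fst ` set es \<subseteq> W \<and> P \<subseteq> W \<and> card P = k \<and>
    (\<forall>p \<in> P. poised m I p (procs D p) (r p)) \<and> (\<forall>x. card {p \<in> P. r p = x} \<le> 3)"
  using assms
proof (induction k arbitrary: W C)
  case 0
  have "execution n m I C [] C" by (rule execution_Nil)
  then show ?case by (intro exI[of _ "[]"] exI[of _ C] exI[of _ "{}"]) auto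
next
  case (Suc k)
  have finW: "finite W" using Suc.prems(1) finite_subset by blast
  obtain Q where Q: "Q \<subseteq> W" "card Q = 2"
    using Suc.prems(2) obtain_subset_with_card_n[of 2 W] by auto
  then obtain q0 q1 where q01: "Q = {q0, q1}" "q0 \<noteq> q1" by (auto simp: card_2_iff)
  define V where "V = W - Q"
  have V: "V \<subseteq> {..<n}" "card V = 2 * k" "V \<subseteq> W" "{q0, q1} \<inter> V = {}"
    using Suc.prems(1,2) Q q01 card_Diff_subset[of Q W] finW finite_subset[of Q W]
    unfolding V_def by auto
  have Qn: "{q0, q1} \<subseteq> {..<n}" "{q0, q1} \<subseteq> W" using Q q01 Suc.prems(1) by auto
  have finV: "finite V" using V(3) finW finite_subset by blast
  \<comment> \<open>A visit is a triple \<open>(D, P, r)\<close>. The map \<open>r\<close> is part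
    of it because a non-deterministic process may be poised at several registers.\<close>
  define good where "good = (\<lambda>(D, P, r). (\<exists>es. execution n m I C es D \<and> fst ` set es \<subseteq> V) \<and>
    P \<subseteq> V \<and> card P = k \<and> (\<forall>p \<in> P. poised m I p (procs D p) (r p)) \<and>
    (\<forall>x. card {p \<in> P. r p = x} \<le> 3))"
  define X :: "('s, 'v) config \<times> nat set \<times> (nat \<Rightarrow> nat) \<Rightarrow> nat set"
    where "X = (\<lambda>(D, P, r). {x. card {p \<in> P. r p = x} = 3})"
  \<comment> \<open>Two runs lead from visit \<open>a\<close> to visit \<open>b\<close>: one by
    \<open>V\<close> alone, and one ending in the same configuration except that a process set aside
    is poised outside \<open>X a\<close>.\<close>
  define next_to where "next_to = (\<lambda>a b :: ('s, 'v) config \<times> nat set \<times> (nat \<Rightarrow> nat).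
    (\<exists>es. execution n m I (fst a) es (fst b) \<and> fst ` set es \<subseteq> V) \<and>
    (\<exists>q \<in> {q0, q1}. \<exists>fs st x. execution n m I (fst a) fs ((fst b)\<lparr>procs := (procs (fst b))(q := st)\<rparr>) \<and>
      fst ` set fs \<subseteq> W \<and> x \<notin> X a \<and> poised m I q st x))"
  have "\<exists>f. \<forall>i. good (f i) \<and> next_to (f i) (f (Suc i))"
  proof (rule dependent_nat_choice)
    have "\<forall>p \<in> V. \<exists>s. procs C p = Idle s" using Suc.prems(4) V(3) by blast
    from Suc.IH[OF V(1,2) Suc.prems(3) this]
    show "\<exists>a. good a" unfolding good_def by (auto simp: split_def)
  next
    fix a and i :: nat
    assume "good a"
    then obtain D P r es where a: "a = (D, P, r)" and es: "execution n m I C es D" "fst ` set es \<subseteq> V"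
      and P: "P \<subseteq> V" "card P = k" "\<forall>p \<in> P. poised m I p (procs D p) (r p)"
      unfolding good_def by auto
    have D: "reachable n m I D" using reachable_execution[OF Suc.prems(3) es(1)] .
    \<comment> \<open>Visits are reached by \<open>V\<close> alone, so both processes set aside are
      still idle at each of them.\<close>
    have "\<exists>s. procs D q = Idle s" if "q \<in> {q0, q1}" for q
    proof -
      have "q \<notin> fst ` set es" using es(2) that V(4) by blast
      then show ?thesis using execution_procs_other[OF es(1)] that Suc.prems(4) Qn(2) by auto
    qed
    then have "\<forall>q \<in> {q0, q1}. \<exists>s. procs D q = Idle s" by blast
    from next_visit[OF D V(1) P(1,3) q01(2) V(4) Qn(1) this]
    obtain q us D' fs st x where us: "q \<in> {q0, q1}" "execution n m I D us D'" "fst ` set us \<subseteq> V"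
      "\<forall>p \<in> V. \<exists>s. procs D' p = Idle s"
      and fs: "execution n m I D fs (D'\<lparr>procs := (procs D')(q := st)\<rparr>)" "fst ` set fs \<subseteq> insert q V"
      "card {p \<in> P. r p = x} \<noteq> 3" "poised m I q st x" by (elim bexE exE conjE) simp
    obtain vs D'' P' r' where vs: "execution n m I D' vs D''" "fst ` set vs \<subseteq> V"
      and P': "P' \<subseteq> V" "card P' = k" "\<forall>p \<in> P'. poised m I p (procs D'' p) (r' p)"
      "\<forall>x. card {p \<in> P'. r' p = x} \<le> 3"
      using Suc.IH[OF V(1,2) reachable_execution[OF D us(2)] us(4)] by blast
    have "execution n m I C (es @ us @ vs) D''" "fst ` set (es @ us @ vs) \<subseteq> V"
      using execution_append[OF es(1) execution_append[OF us(2) vs(1)]] es(2) us(3) vs(2) by auto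
    then have "good (D'', P', r')" using P' unfolding good_def by blast
    moreover have "next_to a (D'', P', r')"
    proof -
      have "q \<notin> fst ` set vs" using vs(2) us(1) V(4) by blast
      then have "execution n m I D (fs @ vs) (D''\<lparr>procs := (procs D'')(q := st)\<rparr>)"
        using execution_append[OF fs(1)] execution_ignore_proc[OF vs(1)] by blast
      moreover have "fst ` set (fs @ vs) \<subseteq> W" using fs(2) vs(2) V(3) Qn(2) us(1) by auto
      moreover have "execution n m I D (us @ vs) D''" "fst ` set (us @ vs) \<subseteq> V"
        using execution_append[OF us(2) vs(1)] us(3) vs(2) by auto
      moreover have "x \<notin> X a" using fs(3) unfolding X_def a by simp
      ultimately show ?thesis
        using us(1) fs(4) unfolding next_to_def a fst_conv by blast
    qed
    ultimately show "\<exists>b. good b \<and> next_to a b" by blast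
  qed
  then obtain f where good: "\<And>i. good (f i)" and nxt: "\<And>i. next_to (f i) (f (Suc i))" by blast
  have "X (f i) \<subseteq> {..<m}" for i
  proof
    fix x assume x: "x \<in> X (f i)"
    obtain D P r where f: "f i = (D, P, r)" by (cases "f i") auto
    then have "{p \<in> P. r p = x} \<noteq> {}" using x unfolding X_def by (auto simp del: Collect_empty_eq)
    then obtain p where "p \<in> P" "r p = x" by blast
    then show "x \<in> {..<m}" using good[of i] f unfolding good_def poised_def by auto
  qed
  \<comment> \<open>Pigeonhole: infinitely many visits, but only finitely many sets of
    registers.\<close>
  then have "range (\<lambda>i. X (f i)) \<subseteq> Pow {..<m}" by blast
  then have "finite (range (\<lambda>i. X (f i)))" by (rule finite_subset) simp
  then have "\<not> inj (\<lambda>i. X (f i))" using finite_imageD infinite_UNIV_nat by blast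
  then obtain i j where ij: "i < j" "X (f i) = X (f j)"
    unfolding inj_def by (metis linorder_neqE_nat)
  have later: "\<exists>es. execution n m I (fst (f i)) es (fst (f j)) \<and> fst ` set es \<subseteq> V" if "i \<le> j" for i j
    using that
  proof (induction rule: dec_induct)
    case base
    then show ?case using execution_Nil by fastforce
  next
    case (step j)
    then obtain es where es: "execution n m I (fst (f i)) es (fst (f j))" "fst ` set es \<subseteq> V" by blast
    obtain us where us: "execution n m I (fst (f j)) us (fst (f (Suc j)))" "fst ` set us \<subseteq> V"
      using nxt[of j] unfolding next_to_def by blast
    have "fst ` set (es @ us) \<subseteq> V" using es(2) us(2) by auto
    then show ?case using execution_append[OF es(1) us(1)] by blast
  qed
  obtain es where es: "execution n m I C es (fst (f i))" "fst ` set es \<subseteq> V"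
    using good[of i] unfolding good_def by (auto simp: split_def)
  \<comment> \<open>Only the segment from visit \<open>i\<close> to the next one is replaced by its
    variant with \<open>q\<close>; from there to visit \<open>j\<close> the processes of
    \<open>V\<close> proceed as before.\<close>
  obtain q fs st x where qx: "q \<in> {q0, q1}" "x \<notin> X (f i)" "poised m I q st x"
    and fs: "execution n m I (fst (f i)) fs
        ((fst (f (Suc i)))\<lparr>procs := (procs (fst (f (Suc i))))(q := st)\<rparr>)" "fst ` set fs \<subseteq> W"
    using nxt[of i] unfolding next_to_def by (elim conjE bexE exE) simp
  obtain us where us: "execution n m I (fst (f (Suc i))) us (fst (f j))" "fst ` set us \<subseteq> V"
    using later[of "Suc i" j] ij(1) by auto
  obtain D P r where f: "f j = (D, P, r)" by (cases "f j") auto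
  have P: "P \<subseteq> V" "card P = k" "\<And>p. p \<in> P \<Longrightarrow> poised m I p (procs D p) (r p)"
    "\<And>x. card {p \<in> P. r p = x} \<le> 3"
    using good[of j] unfolding f good_def by auto
  let ?D = "D\<lparr>procs := (procs D)(q := st)\<rparr>"
  have "q \<notin> fst ` set us" using us(2) qx(1) V(4) by blast
  then have ex: "execution n m I C (es @ fs @ us) ?D"
    using execution_append[OF es(1) execution_append[OF fs(1) execution_ignore_proc[OF us(1)]]] f
    by simp
  have sub: "fst ` set (es @ fs @ us) \<subseteq> W" "insert q P \<subseteq> W"
    using es(2) fs(2) us(2) V(3) P(1) qx(1) Qn(2) by auto
  have qP: "q \<notin> P" using P(1) V(4) qx(1) by auto
  have finP: "finite P" using P(1) finV finite_subset by blast
  have card: "card (insert q P) = Suc k" using P(2) qP finP by simp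
  have poi: "\<forall>p \<in> insert q P. poised m I p (procs ?D p) ((r(q := x)) p)"
    using P(3) qx(3) qP by auto
  have "card {p \<in> insert q P. (r(q := x)) p = y} \<le> 3" for y
  proof -
    have "{p \<in> insert q P. (r(q := x)) p = y} =
      (if y = x then insert q {p \<in> P. r p = y} else {p \<in> P. r p = y})"
      using qP by auto
    \<comment> \<open>\<open>x\<close> lies outside \<open>X (f i) = X (f j)\<close>, so at visit
      \<open>j\<close> it is covered at most twice and there is room for \<open>q\<close>.\<close>
    moreover have "card {p \<in> P. r p = x} \<noteq> 3" using qx(2) ij(2) f unfolding X_def by simp
    ultimately show ?thesis using P(4)[of y] finP qP by auto
  qed
  then show ?case using ex sub card poi
    by (intro exI[of _ "es @ fs @ us"] exI[of _ ?D] exI[of _ "insert q P"] exI[of _ "r(q := x)"]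
        conjI allI)
qed

end

section \<open>Counting registers\<close>

theorem theorem1p1:
  fixes n m :: nat and I :: "('s, 'v, 't) impl"
  assumes "n \<ge> 1"
    and "long_lived_timestamp_impl n m I"
    and "nondet_solo_termination n m I"
  shows "real m \<ge> real n / 6 - 1"
proof -
  interpret timestamp_impl n m I using assms(2,3) by unfold_locales
  \<comment> \<open>The largest even number of processes; for odd \<open>n\<close> one is left out,
    so \<open>n \<le> 2 * (n div 2) + 1\<close>.\<close>
  let ?W = "{..<2 * (n div 2)}"
  have 1: "reachable n m I (init_config I)" unfolding reachable_def using execution_Nil by blast
  have 2: "\<forall>p \<in> ?W. \<exists>s. procs (init_config I) p = Idle s"
    unfolding init_config_def by simp
  have "?W \<subseteq> {..<n}" "card ?W = 2 * (n div 2)" by auto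
  from covering_reachable[OF this 1 2]
  obtain es D P r where "execution n m I (init_config I) es D"
    and P: "card P = n div 2" "\<forall>p \<in> P. poised m I p (procs D p) (r p)"
      "\<forall>x. card {p \<in> P. r p = x} \<le> 3"
    by (elim exE conjE) (rule that)
  \<comment> \<open>\<open>r\<close> assigns each of the \<open>n div 2\<close> covering processes
    to one of \<open>m\<close> registers, and each register receives at most three.\<close>
  have "P = (\<Union>x<m. {p \<in> P. r p = x})" using P(2) unfolding poised_def by auto
  then have "card P \<le> (\<Sum>x<m. card {p \<in> P. r p = x})"
    using card_UN_le[of "{..<m}" "\<lambda>x. {p \<in> P. r p = x}"] by simp
  also have "\<dots> \<le> 3 * m"
    using sum_bounded_above[of "{..<m}" "\<lambda>x. card {p \<in> P. r p = x}" 3] P(3)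
    by (simp add: mult.commute)
  finally have "n div 2 \<le> 3 * m" using P(1) by simp
  then have "n \<le> 6 * m + 6" by linarith
  then have "real n \<le> 6 * real m + 6" by linarith
  then show ?thesis by simp
qed

end
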